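(* Let $\Omega\subset\mathbb{R}^n$ be a bounded domain with $C^2$ boundary, and let $a^1,\dots,a^n\in C^1(\overline\Omega)$ be such that the diagonal matrix $A=\operatorname{diag}(a^1,\dots,a^n)$ is uniformly positive definite over $\overline\Omega$. Write $a^{ij}=a^i$ if $i=j$ and $a^{ij}=0$ if $i\neq j$. Suppose that either $a^k_{x_1}>0$ on $\overline\Omega$ for all $2\le k\le n$, or $a^k_{x_1}<0$ on $\overline\Omega$ for all $2\le k\le n$. Then there exist a function $d\in C^2(\overline\Omega)$ and a constant $\mu_0>0$ such that $$\sum_{i,j=1}^n\bigg\{\sum_{i',j'=1}^n\Big[2a^{ij'}\big(a^{i'j}d_{x_{i'}}\big)_{x_{j'}}-a^{ij}_{x_{j'}}a^{i'j'}d_{x_{i'}}\Big]\bigg\}\xi_i\xi_j\ \ge\ \mu_0\sum_{i,j=1}^n a^{ij}\xi_i\xi_j$$ for all $(x,\xi_1,\dots,\xi_n)\in\overline\Omega\times\mathbb{R}^n$, and $|\nabla d|>0$ in $\overline\Omega$.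
   Context: Subscripts $x_k$ denote partial derivatives with respect to the $k$-th coordinate, e.g. $a^i_{x_k}=\partial a^i/\partial x_k$, $a^{ij}_{x_k}=\partial a^{ij}/\partial x_k$, and $d_{x_k}=\partial d/\partial x_k$. For functions in $C^1(\overline\Omega)$ or $C^2(\overline\Omega)$, derivatives on $\partial\Omega$ are understood as the continuous extensions to $\overline\Omega$. A matrix-valued function $A(x)$ is uniformly positive definite over $\overline\Omega$ if there is a constant $c_0>0$ with $\sum_{i,j}a^{ij}(x)\xi_i\xi_j\ge c_0|\xi|^2$ for all $x\in\overline\Omega$, $\xi\in\mathbb{R}^n$. *)

theory Defs
  imports "HOL-Analysis.Analysis"
begin

definition partial_exists :: "'n::finite \<Rightarrow> (real^'n \<Rightarrow> real) \<Rightarrow> real^'n \<Rightarrow> bool" where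
  "partial_exists k f x \<longleftrightarrow> (\<lambda>t. f (x + t *\<^sub>R axis k 1)) field_differentiable (at 0)"

definition partial :: "'n::finite \<Rightarrow> (real^'n \<Rightarrow> real) \<Rightarrow> real^'n \<Rightarrow> real" where
  "partial k f x = deriv (\<lambda>t. f (x + t *\<^sub>R axis k 1)) 0"

text \<open>The partial derivative of a function on the closure of an open set \<open>\<Omega>\<close>: on the boundary
  it is the limit of the partial derivatives taken inside \<open>\<Omega>\<close>, so that it is the continuous
  extension whenever one exists.\<close>

definition partial_closure ::
    "(real^'n::finite) set \<Rightarrow> 'n \<Rightarrow> (real^'n \<Rightarrow> real) \<Rightarrow> real^'n \<Rightarrow> real" where
  "partial_closure \<Omega> k f x =
     (if x \<in> \<Omega> then partial k f x else Lim (at x within \<Omega>) (partial k f))"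

text \<open>\<open>C_closure m \<Omega> f\<close> means that \<open>f\<close> is of class \<open>C\<^sup>m\<close> on the closure of the open set \<open>\<Omega>\<close>:
  all partial derivatives of order at most \<open>m\<close> exist in \<open>\<Omega>\<close> and extend continuously to the
  closure. Only the values of \<open>f\<close> on the closure matter. For \<open>\<Omega> = UNIV\<close> this is the usual class
  \<open>C\<^sup>m\<close> on the whole space.\<close>

primrec C_closure :: "nat \<Rightarrow> (real^'n::finite) set \<Rightarrow> (real^'n \<Rightarrow> real) \<Rightarrow> bool" where
  "C_closure 0 \<Omega> f \<longleftrightarrow> continuous_on (closure \<Omega>) f"
| "C_closure (Suc m) \<Omega> f \<longleftrightarrow> continuous_on (closure \<Omega>) f \<and>
     (\<forall>k. (\<forall>x\<in>\<Omega>. partial_exists k f x) \<and> C_closure m \<Omega> (partial_closure \<Omega> k f))"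

definition grad_closure :: "(real^'n::finite) set \<Rightarrow> (real^'n \<Rightarrow> real) \<Rightarrow> real^'n \<Rightarrow> real^'n" where
  "grad_closure \<Omega> f x = (\<chi> k. partial_closure \<Omega> k f x)"

text \<open>Near each boundary point, \<open>\<Omega>\<close> is the region strictly on one side of the graph of a \<open>C\<^sup>m\<close>
  function \<open>\<gamma>\<close> of the coordinates other than \<open>x\<^sub>i\<close>, for a suitable coordinate \<open>i\<close>. Such a \<open>\<gamma>\<close> is
  encoded as a function on the whole space that does not depend on \<open>x\<^sub>i\<close>; the sign \<open>s\<close> selects
  the side.\<close>

definition C_boundary :: "nat \<Rightarrow> (real^'n::finite) set \<Rightarrow> bool" where
  "C_boundary m \<Omega> \<longleftrightarrow>
     (\<forall>p\<in>frontier \<Omega>. \<exists>r>0. \<exists>i. \<exists>s\<in>{1, -1}. \<exists>\<gamma>.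
        C_closure m UNIV \<gamma> \<and> (\<forall>x t. \<gamma> (x + t *\<^sub>R axis i 1) = \<gamma> x) \<and>
        \<Omega> \<inter> ball p r = {x \<in> ball p r. s * (x $ i - \<gamma> x) > 0})"

definition bounded_C_domain :: "nat \<Rightarrow> (real^'n::finite) set \<Rightarrow> bool" where
  "bounded_C_domain m \<Omega> \<longleftrightarrow>
     open \<Omega> \<and> connected \<Omega> \<and> \<Omega> \<noteq> {} \<and> bounded \<Omega> \<and> C_boundary m \<Omega>"

text \<open>Matrix-valued functions are given by their families of entries.\<close>

definition uniformly_pos_def_on ::
    "(real^'n::finite) set \<Rightarrow> ('n \<Rightarrow> 'n \<Rightarrow> real^'n \<Rightarrow> real) \<Rightarrow> bool" where
  "uniformly_pos_def_on S A \<longleftrightarrow>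
     (\<exists>c>0. \<forall>x\<in>S. \<forall>\<xi>::real^'n.
        (\<Sum>i\<in>UNIV. \<Sum>j\<in>UNIV. A i j x * \<xi> $ i * \<xi> $ j) \<ge> c * (norm \<xi>)\<^sup>2)"

definition diag :: "('n \<Rightarrow> real^'n \<Rightarrow> real) \<Rightarrow> 'n \<Rightarrow> 'n \<Rightarrow> real^'n::finite \<Rightarrow> real" where
  "diag a i j = (if i = j then a i else (\<lambda>x. 0))"

end

theory Submission imports Defs begin

text \<open>
  Take \<open>d x = exp (c * x\<^sub>1)\<close>. Writing \<open>E = exp (c * x\<^sub>1)\<close>, the quadratic form on the left-hand side
  becomes \<open>E\<close> times
  \<open>2 (a\<^sup>1)\<^sup>2 c\<^sup>2 \<xi>\<^sub>1\<^sup>2 + c \<Sum>\<^sub>i (2 a\<^sup>i (\<partial>\<^sub>i a\<^sup>1) \<xi>\<^sub>i \<xi>\<^sub>1 - a\<^sup>1 (\<partial>\<^sub>1 a\<^sup>i) \<xi>\<^sub>i\<^sup>2)\<close>.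
  Choosing the sign of \<open>c\<close> opposite to that of the \<open>\<partial>\<^sub>1 a\<^sup>k\<close> makes the terms \<open>\<xi>\<^sub>k\<^sup>2\<close>, \<open>k \<noteq> 1\<close>,
  positive; the mixed terms are absorbed by them and by \<open>\<xi>\<^sub>1\<^sup>2\<close>, whose coefficient dominates for
  large \<open>\<bar>c\<bar>\<close> because it is quadratic in \<open>c\<close> whereas everything else is linear.
\<close>

section \<open>Partial derivatives and \<open>C_closure\<close>: locality and boundary
  values\<close>

lemma eventually_axis_line_in_open:
  assumes "open \<Omega>" "(x::real^'n::finite) \<in> \<Omega>"
  shows "eventually (\<lambda>t. x + t *\<^sub>R axis k 1 \<in> \<Omega>) (nhds 0)"
proof -
  have "open ((\<lambda>t. x + t *\<^sub>R axis k 1) -` \<Omega>)"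
    using assms(1) by (intro open_vimage) (auto intro!: continuous_intros)
  then have "eventually (\<lambda>t. t \<in> (\<lambda>t. x + t *\<^sub>R axis k 1) -` \<Omega>) (nhds 0)"
    using assms(2) by (intro eventually_nhds_in_open) auto
  then show ?thesis by simp
qed

lemma partial_cong:
  assumes "open \<Omega>" "x \<in> \<Omega>" "\<And>y. y \<in> \<Omega> \<Longrightarrow> f y = g y"
  shows "partial k f x = partial k g x"
  unfolding partial_def
  by (intro deriv_cong_ev eventually_mono[OF eventually_axis_line_in_open[OF assms(1,2), of k]])
    (auto simp: assms)

lemma partial_exists_cong:
  assumes "open \<Omega>" "x \<in> \<Omega>" "\<And>y. y \<in> \<Omega> \<Longrightarrow> f y = g y"
  shows "partial_exists k f x \<longleftrightarrow> partial_exists k g x"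
proof -
  have "eventually (\<lambda>t. f (x + t *\<^sub>R axis k 1) = g (x + t *\<^sub>R axis k 1)) (nhds 0)"
    by (intro eventually_mono[OF eventually_axis_line_in_open[OF assms(1,2), of k]]) (auto simp: assms)
  then show ?thesis
    unfolding partial_exists_def field_differentiable_def
    by (auto simp: DERIV_cong_ev)
qed

lemma Lim_within_cong:
  assumes "\<And>y. y \<in> S \<Longrightarrow> f y = g y"
  shows "Lim (at x within S) f = Lim (at x within S) g"
proof -
  have "eventually (\<lambda>y. f y = g y) (at x within S)"
    using assms by (auto simp: eventually_at_filter)
  then show ?thesis
    unfolding t2_space_class.Lim_def by (simp add: filterlim_cong)
qed

text \<open>Agreement inside \<open>\<Omega>\<close> suffices even at boundary points, because the
  value there is a limit of partial derivatives taken within \<open>\<Omega>\<close>.\<close>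

lemma partial_closure_cong:
  assumes "open \<Omega>" "\<And>y. y \<in> \<Omega> \<Longrightarrow> f y = g y"
  shows "partial_closure \<Omega> k f x = partial_closure \<Omega> k g x"
proof -
  have "partial k f y = partial k g y" if "y \<in> \<Omega>" for y
    using partial_cong[OF assms(1) that assms(2)] .
  then show ?thesis
    unfolding partial_closure_def by (auto intro: Lim_within_cong)
qed

text \<open>No induction on \<open>m\<close> is needed: the first derivatives of \<open>f\<close>
  and \<open>g\<close> are equal as functions on the whole space. This lets an explicit formula
  replace a \<open>partial_closure\<close> that it matches only on the closure.\<close>

lemma C_closure_cong:
  assumes "open \<Omega>" "\<And>y. y \<in> closure \<Omega> \<Longrightarrow> f y = g y"
  shows "C_closure m \<Omega> f \<longleftrightarrow> C_closure m \<Omega> g"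
proof (cases m)
  case 0
  then show ?thesis using assms by (simp cong: continuous_on_cong)
next
  case (Suc n)
  have eq: "f y = g y" if "y \<in> \<Omega>" for y
    using assms(2) that closure_subset by blast
  have "partial_closure \<Omega> k f = partial_closure \<Omega> k g" for k
    by (rule ext, rule partial_closure_cong[OF assms(1) eq])
  moreover have "partial_exists k f x \<longleftrightarrow> partial_exists k g x" if "x \<in> \<Omega>" for k x
    using partial_exists_cong[OF assms(1) that eq] .
  moreover have "continuous_on (closure \<Omega>) f \<longleftrightarrow> continuous_on (closure \<Omega>) g"
    using assms(2) by (simp cong: continuous_on_cong)
  ultimately show ?thesis
    unfolding Suc by simp
qed

text \<open>A point of the closure outside \<open>\<Omega>\<close> is a limit point of
  \<open>\<Omega>\<close>, so the limit defining the boundary value is unique, and continuity of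
  \<open>g\<close> identifies it. All boundary derivatives below are computed this way.\<close>

lemma partial_closure_eqI:
  assumes cont: "continuous_on (closure \<Omega>) g"
    and eq: "\<And>y. y \<in> \<Omega> \<Longrightarrow> partial k f y = g y"
    and x: "x \<in> closure \<Omega>"
  shows "partial_closure \<Omega> k f x = g x"
proof (cases "x \<in> \<Omega>")
  case True
  then show ?thesis using eq by (simp add: partial_closure_def)
next
  case False
  with x have "x islimpt \<Omega>"
    by (simp add: closure_def)
  then have nt: "at x within \<Omega> \<noteq> bot"
    by (simp add: trivial_limit_within)
  have "(g \<longlongrightarrow> g x) (at x within closure \<Omega>)"
    using cont x by (simp add: continuous_on_def)
  then have "(g \<longlongrightarrow> g x) (at x within \<Omega>)"
    by (rule tendsto_within_subset) (rule closure_subset)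
  then have "Lim (at x within \<Omega>) g = g x"
    by (rule tendsto_Lim[OF nt])
  with False show ?thesis
    using Lim_within_cong[of \<Omega> "partial k f" g x] eq by (simp add: partial_closure_def)
qed

lemma C_closure_imp_continuous_on: "C_closure m \<Omega> f \<Longrightarrow> continuous_on (closure \<Omega>) f"
  by (cases m) auto

text \<open>The candidates \<open>g k\<close> are continuous on the closure, so they are also the
  boundary extensions of the derivatives of \<open>f\<close>.\<close>

lemma C_closure_SucI:
  assumes "open \<Omega>" "continuous_on (closure \<Omega>) f"
    and der: "\<And>k x. x \<in> \<Omega> \<Longrightarrow> ((\<lambda>t. f (x + t *\<^sub>R axis k 1)) has_real_derivative g k x) (at 0)"
    and g: "\<And>k. C_closure m \<Omega> (g k)"
  shows "C_closure (Suc m) \<Omega> f"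
proof -
  have "partial_closure \<Omega> k f x = g k x" if "x \<in> closure \<Omega>" for k x
    using C_closure_imp_continuous_on[OF g] DERIV_imp_deriv[OF der] that
    by (intro partial_closure_eqI) (auto simp: partial_def)
  then have "C_closure m \<Omega> (partial_closure \<Omega> k f)" for k
    using C_closure_cong[OF assms(1), of "partial_closure \<Omega> k f" "g k"] g by blast
  moreover have "partial_exists k f x" if "x \<in> \<Omega>" for k x
    using der[OF that] by (auto simp: partial_exists_def field_differentiable_def)
  ultimately show ?thesis
    using assms(2) by simp
qed

section \<open>Differentiation rules up to the boundary\<close>

lemma has_derivative_partial_closure:
  assumes "C_closure (Suc m) \<Omega> f" "x \<in> \<Omega>"
  shows "((\<lambda>t. f (x + t *\<^sub>R axis k 1)) has_real_derivative partial_closure \<Omega> k f x) (at 0)"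
  using assms by (auto simp: partial_closure_def partial_def partial_exists_def
      field_differentiable_derivI DERIV_deriv_iff_field_differentiable)

lemma partial_closure_mult:
  assumes f: "C_closure 1 \<Omega> f" and g: "C_closure 1 \<Omega> g" and x: "x \<in> closure \<Omega>"
  shows "partial_closure \<Omega> k (\<lambda>y. f y * g y) x =
    partial_closure \<Omega> k f x * g x + f x * partial_closure \<Omega> k g x"
proof (rule partial_closure_eqI[OF _ _ x])
  show "continuous_on (closure \<Omega>)
      (\<lambda>x. partial_closure \<Omega> k f x * g x + f x * partial_closure \<Omega> k g x)"
    using f g by (auto intro!: continuous_intros)
next
  fix y assume y: "y \<in> \<Omega>"
  show "partial k (\<lambda>y. f y * g y) y =
      partial_closure \<Omega> k f y * g y + f y * partial_closure \<Omega> k g y"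
    unfolding partial_def
    using has_derivative_partial_closure[OF f[unfolded One_nat_def] y, of k]
      has_derivative_partial_closure[OF g[unfolded One_nat_def] y, of k]
    by (intro DERIV_imp_deriv) (auto intro!: derivative_eq_intros)
qed

lemma partial_closure_const:
  assumes "x \<in> closure \<Omega>"
  shows "partial_closure \<Omega> k (\<lambda>y. b) x = 0"
  using assms by (intro partial_closure_eqI) (auto simp: partial_def)

lemma exp_coordinate_has_derivative:
  fixes x :: "real^'n::finite"
  shows "((\<lambda>t. b * exp (c * (x + t *\<^sub>R axis k 1) $ l)) has_real_derivative
    (if k = l then b * c else 0) * exp (c * x $ l)) (at 0)"
  by (auto intro!: derivative_eq_intros simp: axis_def)

text \<open>The factor \<open>b\<close> makes the family closed under differentiation: each partial
  derivative has the same shape with \<open>b * c\<close> or \<open>0\<close> in place of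
  \<open>b\<close>. Hence the induction with \<open>b\<close> arbitrary.\<close>

lemma C_closure_exp_coordinate:
  fixes \<Omega> :: "(real^'n::finite) set"
  assumes "open \<Omega>"
  shows "C_closure m \<Omega> (\<lambda>x. b * exp (c * x $ l))"
proof (induction m arbitrary: b)
  case 0
  show ?case by (auto intro!: continuous_intros)
next
  case (Suc m)
  show ?case
    by (rule C_closure_SucI[OF assms _ exp_coordinate_has_derivative Suc]) (intro continuous_intros)
qed

lemma partial_closure_exp_coordinate:
  fixes \<Omega> :: "(real^'n::finite) set"
  assumes "x \<in> closure \<Omega>"
  shows "partial_closure \<Omega> k (\<lambda>x. b * exp (c * x $ l)) x =
    (if k = l then b * c else 0) * exp (c * x $ l)"
  by (rule partial_closure_eqI[OF _ _ assms])
    (auto intro!: continuous_intros DERIV_imp_deriv[OF exp_coordinate_has_derivative]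
      simp only: partial_def)

section \<open>Uniform bounds for finite families on compact sets\<close>

lemma compact_family_lower_bound:
  fixes f :: "'i::finite \<Rightarrow> 'a::topological_space \<Rightarrow> real"
  assumes "compact S" "\<And>k. continuous_on S (f k)" "\<And>k x. x \<in> S \<Longrightarrow> f k x > 0"
  obtains e where "e > 0" "\<And>k x. x \<in> S \<Longrightarrow> e \<le> f k x"
proof (cases "S = {}")
  case True
  then show ?thesis using that[of 1] by auto
next
  case False
  have "\<exists>z\<in>S. \<forall>y\<in>S. f k z \<le> f k y" for k
    using continuous_attains_inf[OF assms(1) False assms(2)] .
  then obtain z where z: "\<And>k. z k \<in> S" "\<And>k y. y \<in> S \<Longrightarrow> f k (z k) \<le> f k y"
    by metis
  show ?thesis
  proof (rule that[of "Min (range (\<lambda>k. f k (z k)))"])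
    show "Min (range (\<lambda>k. f k (z k))) > 0"
      using assms(3) z(1) by (subst Min_gr_iff) auto
  next
    fix k x assume "x \<in> S"
    have "Min (range (\<lambda>k. f k (z k))) \<le> f k (z k)" by (rule Min_le) auto
    also have "\<dots> \<le> f k x" using z(2) \<open>x \<in> S\<close> .
    finally show "Min (range (\<lambda>k. f k (z k))) \<le> f k x" .
  qed
qed

lemma compact_family_upper_bound:
  fixes f :: "'i::finite \<Rightarrow> 'a::topological_space \<Rightarrow> real"
  assumes "compact S" "\<And>k. continuous_on S (f k)"
  obtains B where "B > 0" "\<And>k x. x \<in> S \<Longrightarrow> \<bar>f k x\<bar> \<le> B"
proof -
  have "compact (\<Union>k. f k ` S)"
    using assms by (intro compact_UN compact_continuous_image) auto
  then obtain B where "B > 0" "\<forall>y\<in>(\<Union>k. f k ` S). norm y \<le> B"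
    using compact_imp_bounded bounded_pos by metis
  then show ?thesis
    by (intro that[of B]) auto
qed

section \<open>Diagonal quadratic forms, the form for the exponential, and absorption of mixed
  terms\<close>

lemma diag_quadratic_form:
  fixes x \<xi> :: "real^'n::finite"
  shows "(\<Sum>i\<in>UNIV. \<Sum>j\<in>UNIV. diag a i j x * \<xi> $ i * \<xi> $ j) = (\<Sum>i\<in>UNIV. a i x * (\<xi> $ i)\<^sup>2)"
proof -
  have "diag a i j x * \<xi> $ i * \<xi> $ j = (if i = j then a i x * \<xi> $ i * \<xi> $ i else 0)" for i j
    by (simp add: diag_def)
  then show ?thesis by (simp add: power2_eq_square mult.assoc)
qed

lemma uniformly_pos_def_on_diag:
  fixes a :: "'n::finite \<Rightarrow> real^'n \<Rightarrow> real"
  assumes "uniformly_pos_def_on S (diag a)"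
  obtains \<alpha> where "\<alpha> > 0" "\<And>k x. x \<in> S \<Longrightarrow> \<alpha> \<le> a k x"
proof -
  obtain c where c: "c > 0" "\<And>x \<xi>::real^'n. x \<in> S \<Longrightarrow>
      (\<Sum>i\<in>UNIV. a i x * (\<xi> $ i)\<^sup>2) \<ge> c * (norm \<xi>)\<^sup>2"
    using assms unfolding uniformly_pos_def_on_def diag_quadratic_form by blast
  have "c \<le> a k x" if "x \<in> S" for k x
  proof -
    \<comment> \<open>Testing the form on the k-th unit vector isolates the entry
      \<open>a k x\<close>.\<close>
    have "a i x * (axis k (1::real) $ i)\<^sup>2 = (if i = k then a k x else 0)" for i
      by (simp add: axis_def)
    then show ?thesis
      using c(2)[OF that, of "axis k 1"] by simp
  qed
  with c(1) show ?thesis using that by blast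
qed

text \<open>Only the derivative of \<open>d\<close> in direction \<open>l\<close> is nonzero and
  \<open>diag a\<close> has no off-diagonal entries, so all four sums collapse by Kronecker
  deltas.\<close>

lemma symbol_exp_coordinate:
  fixes \<Omega> :: "(real^'n::finite) set" and c :: real and l :: 'n
  assumes "open \<Omega>" and a: "\<And>i. C_closure 1 \<Omega> (a i)" and x: "x \<in> closure \<Omega>"
  defines "d \<equiv> (\<lambda>x. exp (c * x $ l))"
  shows "(\<Sum>i\<in>UNIV. \<Sum>j\<in>UNIV.
        (\<Sum>i'\<in>UNIV. \<Sum>j'\<in>UNIV.
          2 * diag a i j' x *
            partial_closure \<Omega> j' (\<lambda>y. diag a i' j y * partial_closure \<Omega> i' d y) x
          - partial_closure \<Omega> j' (diag a i j) x * diag a i' j' x * partial_closure \<Omega> i' d x)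
        * \<xi> $ i * \<xi> $ j) =
    exp (c * x $ l) * (2 * (a l x)\<^sup>2 * c\<^sup>2 * (\<xi> $ l)\<^sup>2 +
      (\<Sum>i\<in>UNIV. c * (2 * a i x * partial_closure \<Omega> i (a l) x * \<xi> $ i * \<xi> $ l
        - a l x * partial_closure \<Omega> l (a i) x * (\<xi> $ i)\<^sup>2)))"
    (is "(\<Sum>i\<in>UNIV. \<Sum>j\<in>UNIV. ?M i j * _ * _) = _")
proof -
  let ?P = "partial_closure \<Omega>"
  define E where "E = exp (c * x $ l)"
  have d1: "?P k d y = (if k = l then c else 0) * exp (c * y $ l)" if "y \<in> closure \<Omega>" for k y
    unfolding d_def using partial_closure_exp_coordinate[OF that, of k 1] by simp
  have d1_C: "C_closure 1 \<Omega> (?P k d)" for k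
    using C_closure_cong[OF assms(1),
        of "?P k d" "\<lambda>y. (if k = l then c else 0) * exp (c * y $ l)"] d1
      C_closure_exp_coordinate[OF assms(1)] by blast
  have d2: "?P m (?P k d) x = (if m = l \<and> k = l then c\<^sup>2 else 0) * E" for m k
  proof -
    have "?P m (?P k d) x = ?P m (\<lambda>y. (if k = l then c else 0) * exp (c * y $ l)) x"
      using d1 closure_subset by (intro partial_closure_cong[OF assms(1)]) blast
    then show ?thesis
      using partial_closure_exp_coordinate[OF x, of m "if k = l then c else 0"]
      by (simp add: E_def power2_eq_square)
  qed
  \<comment> \<open>For \<open>i' = j\<close> this is the product rule with \<open>d1\<close> and
    \<open>d2\<close>; otherwise the function is constantly zero.\<close>
  have flux: "?P m (\<lambda>y. diag a i' j y * ?P i' d y) x =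
      (if i' = j \<and> j = l then (?P m (a l) x * c + (if m = l then a l x * c\<^sup>2 else 0)) * E else 0)"
    for m i' j
  proof (cases "i' = j")
    case True
    then show ?thesis
      using partial_closure_mult[OF a d1_C x, of m j j] d1[OF x] d2
      by (simp add: diag_def E_def algebra_simps)
  next
    case False
    then show ?thesis by (simp add: diag_def partial_closure_const[OF x])
  qed
  \<comment> \<open>In the first summand only \<open>j' = i\<close>, \<open>i' = j\<close> survives;
    in the second only \<open>i' = j' = l\<close>, and it vanishes unless
    \<open>i = j\<close>.\<close>
  have M: "?M i j = (if j = l then 2 * a i x * (?P i (a l) x * c + (if i = l then a l x * c\<^sup>2 else 0)) * E else 0)
      - (if i = j then ?P l (a i) x * a l x * c * E else 0)" (is "_ = ?R - ?Q") for i j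
  proof -
    have "2 * diag a i j' x * ?P j' (\<lambda>y. diag a i' j y * ?P i' d y) x =
        (if j' = i then if i' = j then ?R else 0 else 0)" for i' j'
      unfolding flux by (simp add: diag_def)
    moreover have "?P j' (diag a i j) x * diag a i' j' x * ?P i' d x =
        (if j' = l then if i' = l then ?Q else 0 else 0)" for i' j'
      by (auto simp add: diag_def d1[OF x] E_def partial_closure_const[OF x])
    ultimately show ?thesis
      by (simp add: sum_subtractf)
  qed
  have "(\<Sum>j\<in>UNIV. ?M i j * \<xi> $ i * \<xi> $ j) =
      E * (c * (2 * a i x * ?P i (a l) x * \<xi> $ i * \<xi> $ l - a l x * ?P l (a i) x * (\<xi> $ i)\<^sup>2)
        + (if i = l then 2 * (a l x)\<^sup>2 * c\<^sup>2 * (\<xi> $ l)\<^sup>2 else 0))" (is "_ = ?S i") for i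
  proof -
    have "?M i j * \<xi> $ i * \<xi> $ j =
        (if j = l then 2 * a i x * (?P i (a l) x * c + (if i = l then a l x * c\<^sup>2 else 0)) * E * \<xi> $ i * \<xi> $ l else 0)
      - (if j = i then ?P l (a i) x * a l x * c * E * \<xi> $ i * \<xi> $ i else 0)" for j
      unfolding M by (auto simp: algebra_simps)
    then show ?thesis
      by (simp add: sum_subtractf) (auto simp: algebra_simps power2_eq_square)
  qed
  then have "(\<Sum>i\<in>UNIV. \<Sum>j\<in>UNIV. ?M i j * \<xi> $ i * \<xi> $ j) = (\<Sum>i\<in>UNIV. ?S i)"
    by (rule sum.cong[OF refl])
  also have "\<dots> = E * (2 * (a l x)\<^sup>2 * c\<^sup>2 * (\<xi> $ l)\<^sup>2 +
      (\<Sum>i\<in>UNIV. c * (2 * a i x * ?P i (a l) x * \<xi> $ i * \<xi> $ l - a l x * ?P l (a i) x * (\<xi> $ i)\<^sup>2)))"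
    by (simp add: sum_distrib_left[symmetric] sum.distrib)
  finally show ?thesis
    unfolding E_def .
qed

text \<open>Here \<open>u = \<xi>\<^sub>i\<close>, \<open>v = \<xi>\<^sub>1\<close>, \<open>p = \<partial>\<^sub>i a\<^sup>1\<close>, \<open>q = \<partial>\<^sub>1 a\<^sup>i\<close>, and \<open>s\<close> is the sign of \<open>c\<close>.\<close>

lemma mixed_term_lower_bound:
  fixes s :: real
  assumes s: "\<bar>s\<bar> = 1" and "\<kappa> > 0" and B: "\<bar>ai\<bar> \<le> B" "\<bar>al\<bar> \<le> B" "\<bar>p\<bar> \<le> B"
    and q: "- s * q * al \<ge> 2 * \<kappa>"
  shows "s * (2 * ai * p * u * v - al * q * u\<^sup>2) \<ge> \<kappa> * u\<^sup>2 - B ^ 4 / \<kappa> * v\<^sup>2"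
proof -
  define w where "w = s * ai * p"
  have "\<bar>w\<bar> \<le> B\<^sup>2"
    using mult_mono[OF B(1,3)] B s by (simp add: w_def abs_mult power2_eq_square)
  then have w: "w\<^sup>2 \<le> B ^ 4"
    using power_mono[of "\<bar>w\<bar>" "B\<^sup>2" 2] by simp
  \<comment> \<open>Completing the square: the mixed term costs one
    \<open>\<kappa> * u\<^sup>2\<close> of the two supplied by the hypothesis on \<open>q\<close>,
    plus a multiple of \<open>v\<^sup>2\<close>.\<close>
  have "0 \<le> (\<kappa> * u + w * v)\<^sup>2 / \<kappa>"
    using \<open>\<kappa> > 0\<close> by simp
  also have "\<dots> = \<kappa> * u\<^sup>2 + 2 * w * u * v + w\<^sup>2 / \<kappa> * v\<^sup>2"
    using \<open>\<kappa> > 0\<close> by (simp add: field_simps power2_eq_square)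
  also have "\<dots> \<le> \<kappa> * u\<^sup>2 + 2 * w * u * v + B ^ 4 / \<kappa> * v\<^sup>2"
    using \<open>\<kappa> > 0\<close> w by (intro add_left_mono mult_right_mono divide_right_mono) auto
  finally have "2 * w * u * v \<ge> - \<kappa> * u\<^sup>2 - B ^ 4 / \<kappa> * v\<^sup>2" by simp
  moreover have "(- s * q * al) * u\<^sup>2 \<ge> 2 * \<kappa> * u\<^sup>2"
    using q by (rule mult_right_mono) simp
  ultimately show ?thesis
    by (simp add: w_def algebra_simps)
qed

section \<open>Choice of the constants and the final estimate\<close>

theorem corollary1p1:
  fixes \<Omega> :: "(real^'n::finite) set"
    and a :: "'n \<Rightarrow> real^'n \<Rightarrow> real"
    and one :: 'n
  assumes "bounded_C_domain 2 \<Omega>"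
    and "\<And>i. C_closure 1 \<Omega> (a i)"
    and "uniformly_pos_def_on (closure \<Omega>) (diag a)"
    and "(\<forall>k. k \<noteq> one \<longrightarrow> (\<forall>x\<in>closure \<Omega>. partial_closure \<Omega> one (a k) x > 0)) \<or>
         (\<forall>k. k \<noteq> one \<longrightarrow> (\<forall>x\<in>closure \<Omega>. partial_closure \<Omega> one (a k) x < 0))"
  shows "\<exists>(d :: real^'n \<Rightarrow> real) (\<mu>\<^sub>0 :: real).
    C_closure 2 \<Omega> d \<and> \<mu>\<^sub>0 > 0 \<and>
    (\<forall>x\<in>closure \<Omega>. \<forall>\<xi>::real^'n.
      (\<Sum>i\<in>UNIV. \<Sum>j\<in>UNIV.
        (\<Sum>i'\<in>UNIV. \<Sum>j'\<in>UNIV.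
          2 * diag a i j' x *
            partial_closure \<Omega> j' (\<lambda>y. diag a i' j y * partial_closure \<Omega> i' d y) x
          - partial_closure \<Omega> j' (diag a i j) x * diag a i' j' x * partial_closure \<Omega> i' d x)
        * \<xi> $ i * \<xi> $ j)
      \<ge> \<mu>\<^sub>0 * (\<Sum>i\<in>UNIV. \<Sum>j\<in>UNIV. diag a i j x * \<xi> $ i * \<xi> $ j)) \<and>
    (\<forall>x\<in>closure \<Omega>. norm (grad_closure \<Omega> d x) > 0)"
proof -
  let ?P = "partial_closure \<Omega>" and ?K = "closure \<Omega>"
  have "open \<Omega>" and "bounded \<Omega>"
    using assms(1) by (auto simp: bounded_C_domain_def)
  then have "compact ?K" by simp
  have a_cont: "continuous_on ?K (a i)" and Pa_cont: "continuous_on ?K (?P k (a i))" for i k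
    using assms(2)[of i] by auto
  \<comment> \<open>\<open>s\<close> is the sign of the future \<open>c\<close>, opposite to that of
    the derivatives in direction \<open>one\<close>.\<close>
  obtain s :: real where s: "\<bar>s\<bar> = 1" "\<And>k x. k \<noteq> one \<Longrightarrow> x \<in> ?K \<Longrightarrow> - s * ?P one (a k) x > 0"
  proof (cases "\<forall>k. k \<noteq> one \<longrightarrow> (\<forall>x\<in>?K. ?P one (a k) x > 0)")
    case True
    then show ?thesis using that[of "-1"] by auto
  next
    case False
    then show ?thesis using that[of 1] assms(4) by auto
  qed
  obtain \<alpha> where \<alpha>: "\<alpha> > 0" "\<And>k x. x \<in> ?K \<Longrightarrow> \<alpha> \<le> a k x"
    using uniformly_pos_def_on_diag[OF assms(3)] by blast
  \<comment> \<open>The hypothesis gives no sign for the derivative of \<open>a one\<close>; the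
    dummy value 1 there keeps the whole family positive, so one \<open>\<eta>\<close> serves all
    indices.\<close>
  define h where "h = (\<lambda>k x. if k = one then 1 else - s * ?P one (a k) x)"
  have "continuous_on ?K (h k)" for k
    using Pa_cont by (cases "k = one") (auto simp: h_def intro!: continuous_intros)
  moreover have "h k x > 0" if "x \<in> ?K" for k x
    using s(2)[OF _ that, of k] by (simp add: h_def)
  ultimately obtain \<eta> where \<eta>: "\<eta> > 0" "\<And>k x. x \<in> ?K \<Longrightarrow> \<eta> \<le> h k x"
    using compact_family_lower_bound[OF \<open>compact ?K\<close>, of h] by blast
  obtain B1 where B1: "B1 > 0" "\<And>k x. x \<in> ?K \<Longrightarrow> \<bar>a k x\<bar> \<le> B1"
    using compact_family_upper_bound[OF \<open>compact ?K\<close>, of a] a_cont by blast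
  obtain B2 where B2: "B2 > 0" "\<And>k x. x \<in> ?K \<Longrightarrow> \<bar>?P k (a one) x\<bar> \<le> B2"
    using compact_family_upper_bound[OF \<open>compact ?K\<close>, of "\<lambda>k. ?P k (a one)"] Pa_cont by blast
  define B where "B = max B1 B2"
  have B: "B > 0" "\<And>k x. x \<in> ?K \<Longrightarrow> \<bar>a k x\<bar> \<le> B" "\<And>k x. x \<in> ?K \<Longrightarrow> \<bar>?P k (a one) x\<bar> \<le> B"
    using B1 B2 by (auto simp: B_def le_max_iff_disj)
  \<comment> \<open>\<open>\<eta> * \<alpha>\<close> bounds
    \<open>- s * ?P one (a k) x * a one x\<close> from below for \<open>k \<noteq> one\<close>, and
    \<open>mixed_term_lower_bound\<close> asks for \<open>2 * \<kappa>\<close> there.\<close>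
  define \<kappa> where "\<kappa> = \<eta> * \<alpha> / 2"
  have "\<kappa> > 0" using \<alpha> \<eta> by (simp add: \<kappa>_def)
  \<comment> \<open>\<open>B ^ 4 / \<kappa>\<close> pays for the mixed terms with
    \<open>i \<noteq> one\<close>, and \<open>B\<^sup>2 + \<kappa>\<close> for the index
    \<open>one\<close>.\<close>
  define D where "D = B ^ 4 / \<kappa> + B\<^sup>2 + \<kappa>"
  have "D > 0" using \<open>\<kappa> > 0\<close> B(1) by (simp add: D_def add_pos_pos)
  \<comment> \<open>Solves \<open>2 * \<alpha>\<^sup>2 * \<rho>\<^sup>2 = \<rho> * (CARD('n) *
    D)\<close>: the term quadratic in \<open>c\<close> then offsets the loss
    \<open>\<rho> * D\<close> from each of the n indices.\<close>
  define \<rho> where "\<rho> = CARD('n) * D / (2 * \<alpha>\<^sup>2)"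
  have "\<rho> > 0" using \<open>D > 0\<close> \<alpha>(1) by (simp add: \<rho>_def)
  define c where "c = s * \<rho>"
  have "c\<^sup>2 = \<rho>\<^sup>2" using s(1) by (simp add: c_def power_mult_distrib abs_square_eq_1)
  define d where "d = (\<lambda>x::real^'n. exp (c * x $ one))"
  have "continuous_on ?K (\<lambda>x. exp (c * x $ one))"
    by (intro continuous_intros)
  then obtain \<epsilon> where \<epsilon>: "\<epsilon> > 0" "\<And>x. x \<in> ?K \<Longrightarrow> \<epsilon> \<le> exp (c * x $ one)"
    using compact_family_lower_bound[OF \<open>compact ?K\<close>, of "\<lambda>_::unit. \<lambda>x. exp (c * x $ one)"]
      exp_gt_zero by metis
  \<comment> \<open>The form will be at least \<open>\<epsilon> * \<rho> * \<kappa>\<close> times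
    the squared norm of \<open>\<xi>\<close>, while the form of \<open>diag a\<close> is at most
    \<open>B\<close> times it.\<close>
  define \<mu> where "\<mu> = \<epsilon> * \<rho> * \<kappa> / B"
  have "\<mu> > 0" using \<epsilon>(1) \<open>\<rho> > 0\<close> \<open>\<kappa> > 0\<close> B(1) by (simp add: \<mu>_def)

  have term_bound: "c * (2 * a i x * ?P i (a one) x * \<xi> $ i * \<xi> $ one - a one x * ?P one (a i) x * (\<xi> $ i)\<^sup>2)
      \<ge> \<rho> * (\<kappa> * (\<xi> $ i)\<^sup>2 - D * (\<xi> $ one)\<^sup>2)" (is "c * ?T \<ge> _")
    if x: "x \<in> ?K" for x \<xi> i
  proof -
    have "s * ?T \<ge> \<kappa> * (\<xi> $ i)\<^sup>2 - D * (\<xi> $ one)\<^sup>2"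
    proof (cases "i = one")
      case True
      \<comment> \<open>For \<open>i = one\<close> the two parts of \<open>?T\<close> combine to
        \<open>a one x * ?P one (a one) x * (\<xi> $ one)\<^sup>2\<close>, of unknown sign, so only
        its size is used.\<close>
      have "\<bar>s * (a one x * ?P one (a one) x)\<bar> \<le> B\<^sup>2"
        using mult_mono[OF B(2)[OF x, of one] B(3)[OF x, of one]] B(1) s(1)
        by (simp add: abs_mult power2_eq_square)
      then have "s * (a one x * ?P one (a one) x) \<ge> - B\<^sup>2" by linarith
      moreover have "B ^ 4 / \<kappa> > 0" using B(1) \<open>\<kappa> > 0\<close> by simp
      ultimately have "s * (a one x * ?P one (a one) x) \<ge> \<kappa> - D"
        unfolding D_def by linarith
      then have "s * (a one x * ?P one (a one) x) * (\<xi> $ one)\<^sup>2 \<ge> (\<kappa> - D) * (\<xi> $ one)\<^sup>2"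
        by (rule mult_right_mono) simp
      then show ?thesis
        using True by (simp add: algebra_simps power2_eq_square)
    next
      case False
      have "\<eta> * \<alpha> \<le> (- s * ?P one (a i) x) * a one x"
        using \<eta>(2)[OF x, of i] False \<alpha>(2)[OF x, of one] \<eta>(1) \<alpha>(1)
          by (intro mult_mono) (auto simp: h_def)
      then have "s * ?T \<ge> \<kappa> * (\<xi> $ i)\<^sup>2 - B ^ 4 / \<kappa> * (\<xi> $ one)\<^sup>2"
        using mixed_term_lower_bound[OF s(1) \<open>\<kappa> > 0\<close> B(2)[OF x] B(2)[OF x] B(3)[OF x]]
        by (simp add: \<kappa>_def)
      moreover have "B ^ 4 / \<kappa> * (\<xi> $ one)\<^sup>2 \<le> D * (\<xi> $ one)\<^sup>2"
        using \<open>\<kappa> > 0\<close> by (intro mult_right_mono) (auto simp: D_def)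
      ultimately show ?thesis by linarith
    qed
    then have "\<rho> * (s * ?T) \<ge> \<rho> * (\<kappa> * (\<xi> $ i)\<^sup>2 - D * (\<xi> $ one)\<^sup>2)"
      using \<open>\<rho> > 0\<close> by simp
    then show ?thesis
      by (simp only: c_def mult.assoc mult.left_commute)
  qed

  have form_bound: "\<mu> * (\<Sum>i\<in>UNIV. a i x * (\<xi> $ i)\<^sup>2) \<le> exp (c * x $ one) *
      (2 * (a one x)\<^sup>2 * c\<^sup>2 * (\<xi> $ one)\<^sup>2 +
      (\<Sum>i\<in>UNIV. c * (2 * a i x * ?P i (a one) x * \<xi> $ i * \<xi> $ one
        - a one x * ?P one (a i) x * (\<xi> $ i)\<^sup>2)))" (is "_ \<le> _ * ?Q")
    if x: "x \<in> ?K" for x and \<xi> :: "real^'n"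
  proof -
    let ?N = "\<Sum>i\<in>UNIV. (\<xi> $ i)\<^sup>2"
    have "\<alpha>\<^sup>2 \<le> (a one x)\<^sup>2"
      using \<alpha> x by (intro power_mono) auto
    then have "2 * \<alpha>\<^sup>2 * \<rho>\<^sup>2 * (\<xi> $ one)\<^sup>2 \<le> 2 * (a one x)\<^sup>2 * c\<^sup>2 * (\<xi> $ one)\<^sup>2"
      unfolding \<open>c\<^sup>2 = \<rho>\<^sup>2\<close> by (intro mult_right_mono) auto
    moreover have "2 * \<alpha>\<^sup>2 * \<rho>\<^sup>2 = \<rho> * (CARD('n) * D)"
      using \<alpha>(1) by (simp add: \<rho>_def power2_eq_square)
    moreover have "(\<Sum>i\<in>UNIV. \<rho> * (\<kappa> * (\<xi> $ i)\<^sup>2 - D * (\<xi> $ one)\<^sup>2)) \<le>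
        (\<Sum>i\<in>UNIV. c * (2 * a i x * ?P i (a one) x * \<xi> $ i * \<xi> $ one
        - a one x * ?P one (a i) x * (\<xi> $ i)\<^sup>2))"
      using term_bound[OF x] by (rule sum_mono)
    moreover have "(\<Sum>i\<in>UNIV. \<rho> * (\<kappa> * (\<xi> $ i)\<^sup>2 - D * (\<xi> $ one)\<^sup>2)) =
        \<rho> * \<kappa> * ?N - \<rho> * (CARD('n) * D) * (\<xi> $ one)\<^sup>2"
      by (simp add: sum_subtractf sum_distrib_left algebra_simps)
    \<comment> \<open>The negative multiples of \<open>(\<xi> $ one)\<^sup>2\<close> cancel by the
      choice of \<open>\<rho>\<close>, leaving a multiple of the full squared norm.\<close>
    ultimately have Q: "\<rho> * \<kappa> * ?N \<le> ?Q" by simp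
    have "a i x * (\<xi> $ i)\<^sup>2 \<le> B * (\<xi> $ i)\<^sup>2" for i
      using B(2)[OF x, of i] by (intro mult_right_mono) auto
    then have "(\<Sum>i\<in>UNIV. a i x * (\<xi> $ i)\<^sup>2) \<le> B * ?N"
      by (simp add: sum_distrib_left sum_mono)
    then have "\<mu> * (\<Sum>i\<in>UNIV. a i x * (\<xi> $ i)\<^sup>2) \<le> \<mu> * (B * ?N)"
      using \<open>\<mu> > 0\<close> by simp
    also have "\<dots> = \<epsilon> * (\<rho> * \<kappa> * ?N)"
      using B(1) by (simp add: \<mu>_def)
    also have "\<dots> \<le> exp (c * x $ one) * ?Q"
      using \<epsilon>(2)[OF x] Q \<open>\<rho> > 0\<close> \<open>\<kappa> > 0\<close>
      by (intro mult_mono) (auto intro!: mult_nonneg_nonneg sum_nonneg)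
    finally show ?thesis .
  qed

  have "C_closure 2 \<Omega> d"
    using C_closure_exp_coordinate[OF \<open>open \<Omega>\<close>, of 2 1 c one] by (simp add: d_def)
  moreover have "norm (grad_closure \<Omega> d x) > 0" if "x \<in> ?K" for x
  proof -
    \<comment> \<open>The component in direction \<open>one\<close> alone keeps the gradient from
      vanishing.\<close>
    have "grad_closure \<Omega> d x $ one = c * exp (c * x $ one)"
      using partial_closure_exp_coordinate[OF that, of one 1 c one]
      by (simp add: grad_closure_def d_def)
    moreover have "c \<noteq> 0" using s(1) \<open>\<rho> > 0\<close> by (auto simp: c_def)
    ultimately have "grad_closure \<Omega> d x \<noteq> 0" by auto
    then show ?thesis by simp
  qed
  ultimately show ?thesis
    using \<open>\<mu> > 0\<close> form_bound
    by (intro exI[of _ d] exI[of _ \<mu>])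
      (simp add: diag_quadratic_form symbol_exp_coordinate[OF \<open>open \<Omega>\<close> assms(2)] d_def)
qed

end
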